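(* If the noise trade distribution $\mathcal{D}$ of a noisy CFMM mechanism is zero-mean, then a privacy fee exists under which the noisy CFMM mechanism is truthful. The minimum such privacy fee is the noise fee $\Gamma$: for CFMM state $(\tilde x,\mathcal{Y}(\tilde x))$, trade $\tilde\Delta$, privacy specification $(\tilde\tau,\tilde\varepsilon)$ and noise trade distribution $\mathcal{D}$, $$\Gamma=\int_{-\infty}^{\infty}\mathcal{D}(\eta)\int_{\tilde x+\tilde\Delta+\eta}^{\tilde x+\tilde\Delta}\bigl(P(a)-P(\tilde x+\tilde\Delta)\bigr)\,da\,d\eta,$$ which for zero-mean noise trade distributions simplifies to $\Gamma=\int_{-\infty}^{\infty}\mathcal{D}(\eta)\int_{\tilde x+\tilde\Delta+\eta}^{\tilde x+\tilde\Delta}P(a)\,da\,d\eta$.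
   Context: CFMM. A constant function market maker (CFMM) trades a volatile asset $X$ against a stable numeraire $Y$. It is given by a trading function $f$ that is quasi-concave, continuous and non-decreasing in both coordinates on $\mathbb{R}^2_+$. With reserves (state) $(x,y)$ it accepts a trade $(\Delta_x,\Delta_y)$, leading to reserves $(x+\Delta_x,y-\Delta_y)$, if and only if $f(x+\Delta_x,y-\Delta_y)=f(x,y)$. On a given level curve of $f$ the amount $x$ of $X$ uniquely determines the amount of $Y$, denoted $\mathcal{Y}(x)$. Fees are not added to the reserves, so the CFMM stays on its initial level curve. It is assumed that the CFMM never runs out of an asset. Spot price. The spot price at a state is $\frac{\partial f}{\partial x}/\frac{\partial f}{\partial y}$ there (any subgradient where $f$ is not differentiable). On a given level curve, $P(x)$ denotes the spot price when the reserves contain $x$ units of $X$ (the largest subgradient where $f$ is not differentiable). $P$ is monotonically decreasing, $P(x)\to\infty$ as $x\to 0$ and $P(x)\to 0$ as $x\to\infty$. Noisy CFMM mechanism. At state $(x,\mathcal{Y}(x))$, a trader sells $\Delta$ units of $X$ to the CFMM ($\Delta<0$ means buying $X$) and specifies privacy requirements $(\tau,\varepsilon)$: a masking interval $\tau=[l,u]$ with $\Delta\in\tau$ and a privacy level $\varepsilon\ge 0$ (lower means more privacy; $\varepsilon=\infty$ is allowed and means no privacy). The trader receives $\mathcal{Y}(x)-\mathcal{Y}(x+\Delta)$ units of $Y$ and pays a privacy fee $\gamma$; the trading fee is assumed to be zero. The CFMM then immediately makes a random noise trade of $\eta\sim\mathcal{D}$ units of $X$ with a hidden private account, so that the new state is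 $x'=x+\Delta+\eta$, $y'=\mathcal{Y}(x')$, and this state can be queried by the next trader. The hidden account is assumed never to run dry; if it cannot support the maximum possible noise for a trade request, the request is rejected. The noise trade distribution $\mathcal{D}$ has bounded support and, for a given CFMM, depends only on the trade amount $\Delta$ and privacy specification $(\tau,\varepsilon)$, not on the CFMM state; $\mathcal{D}(\eta)$ denotes its density. The privacy fee depends on the CFMM state and on $\mathcal{D}$. When $\varepsilon=\infty$ or $\tau=\{\Delta\}$, both the noise trade and the privacy fee are zero. External market. There is an external market with infinite liquidity; the price $\hat p$ of $X$ in units of $Y$ on it is called the true price. Arbitrageurs know the true price and can trade both with the CFMM and on the external market. Truthfulness. A noisy CFMM mechanism is truthful if a trader with no privacy requirements, strictly increasing utility in $Y$, no utility for $X$, exclusive access to the CFMM, and access to the external market, always maximizes their utility by trading with the CFMM only once such that the post-trade spot price is equal to the true price of $X$, and with privacy level $\varepsilon=\infty$.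
   Formalization: The trader's utility is taken as a strictly increasing function of the expected final amount of Y (risk-neutral); with expected utility the claim fails for strictly convex utilities, which would favour adding noise at fee Γ. *)

theory Defs
  imports "HOL-Probability.Probability"
begin

section \<open>Constant function market makers\<close>

definition nonneg_quadrant :: "(real \<times> real) set" where
  "nonneg_quadrant = {0..} \<times> {0..}"

definition quasi_concave_on :: "'a::real_vector set \<Rightarrow> ('a \<Rightarrow> real) \<Rightarrow> bool" where
  "quasi_concave_on S f \<longleftrightarrow> convex S \<and> (\<forall>c. convex {s \<in> S. c \<le> f s})"

definition trading_function :: "(real \<times> real \<Rightarrow> real) \<Rightarrow> bool" where
  "trading_function f \<longleftrightarrow>
     quasi_concave_on nonneg_quadrant f \<and>
     continuous_on nonneg_quadrant f \<and>
     (\<forall>x x' y y'. 0 \<le> x \<longrightarrow> x \<le> x' \<longrightarrow> 0 \<le> y \<longrightarrow> y \<le> y' \<longrightarrow> f (x, y) \<le> f (x', y'))"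

text \<open>The amount \<open>\<Y>(x)\<close> of the numeraire on the level curve \<open>f = k\<close>.\<close>

definition reserve_Y :: "(real \<times> real \<Rightarrow> real) \<Rightarrow> real \<Rightarrow> real \<Rightarrow> real" where
  "reserve_Y f k x = (THE y. 0 < y \<and> f (x, y) = k)"

text \<open>
  A trading function is only quasi-concave, so a subgradient is meant in the quasi-concave sense:
  the vector \<open>(p, 1)\<close> is normal, at \<open>(x, y)\<close>, to a line supporting the upper level set of \<open>f\<close>.
  (If \<open>f\<close> is concave, then \<open>p = g / h\<close> has this property for every supergradient
  \<open>(g, h)\<close> of \<open>f\<close> with \<open>h > 0\<close>.)
\<close>

definition quasi_subgradient_price :: "(real \<times> real \<Rightarrow> real) \<Rightarrow> real \<Rightarrow> real \<Rightarrow> real \<Rightarrow> bool" where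
  "quasi_subgradient_price f x y p \<longleftrightarrow>
     (\<forall>(x', y') \<in> nonneg_quadrant. f (x, y) \<le> f (x', y') \<longrightarrow> p * x + y \<le> p * x' + y')"

text \<open>
  The spot prices at a state. This set is a singleton where the quotient of the partial derivatives
  makes sense. A differentiable \<open>f\<close> may have zero gradient at a state (as a strictly
  increasing transform of \<open>x * y\<close> can); the quotient is then meaningless, and the state is treated
  like a point where \<open>f\<close> is not differentiable.
\<close>

definition spot_prices :: "(real \<times> real \<Rightarrow> real) \<Rightarrow> real \<Rightarrow> real \<Rightarrow> real set" where
  "spot_prices f x y =
     (if f differentiable (at (x, y)) \<and> deriv (\<lambda>t. f (x, t)) y \<noteq> 0
      then {deriv (\<lambda>t. f (t, y)) x / deriv (\<lambda>t. f (x, t)) y}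
      else {p. quasi_subgradient_price f x y p})"

text \<open>\<open>P(x)\<close>: the spot price on the level curve, the largest one where there are several.\<close>

definition spot_price :: "(real \<times> real \<Rightarrow> real) \<Rightarrow> real \<Rightarrow> real \<Rightarrow> real" where
  "spot_price f k x = Sup (spot_prices f x (reserve_Y f k x))"

text \<open>
  Since fees are not added to the reserves, the market maker stays on the level curve \<open>f = k\<close>
  of its initial reserves, and its state is given by \<open>x > 0\<close>. It never runs out of an asset.
\<close>

definition cfmm :: "(real \<times> real \<Rightarrow> real) \<Rightarrow> real \<Rightarrow> bool" where
  "cfmm f k \<longleftrightarrow>
     trading_function f \<and>
     (\<forall>x>0. \<exists>!y. 0 < y \<and> f (x, y) = k) \<and>
     antimono_on {0<..} (spot_price f k) \<and>
     filterlim (spot_price f k) at_top (at_right 0) \<and>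
     (spot_price f k \<longlongrightarrow> 0) at_top"


section \<open>Noisy mechanisms\<close>

text \<open>
  A trade request: the trader sells \<open>amount\<close> units of X, with masking interval
  \<open>[mask_lo, mask_hi]\<close> and privacy level \<open>privacy\<close>.
\<close>

record request =
  amount :: real
  mask_lo :: real
  mask_hi :: real
  privacy :: ennreal

definition valid_request :: "request \<Rightarrow> bool" where
  "valid_request r \<longleftrightarrow> mask_lo r \<le> amount r \<and> amount r \<le> mask_hi r"

definition no_privacy :: "request \<Rightarrow> bool" where
  "no_privacy r \<longleftrightarrow> privacy r = \<infinity> \<or> {mask_lo r..mask_hi r} = {amount r}"

text \<open>The (closed, topological) support of a Borel measure on the line.\<close>

definition msupport :: "real measure \<Rightarrow> real set" where
  "msupport D = {\<eta>. \<forall>e>0. 0 < emeasure D (ball \<eta> e)}"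

text \<open>
  The noise is the law of the noise trade as a function of the request only. It is an arbitrary
  law on the line and not a density, because it is a point mass for requests without privacy.
\<close>

type_synonym noise = "request \<Rightarrow> real measure"

definition noise_mechanism :: "noise \<Rightarrow> bool" where
  "noise_mechanism N \<longleftrightarrow>
     (\<forall>r. valid_request r \<longrightarrow>
        prob_space (N r) \<and> sets (N r) = sets borel \<and> bounded (msupport (N r)) \<and>
        (no_privacy r \<longrightarrow> N r = return borel 0))"

definition zero_mean :: "noise \<Rightarrow> bool" where
  "zero_mean N \<longleftrightarrow> (\<forall>r. valid_request r \<longrightarrow> (LINT \<eta>|N r. \<eta>) = 0)"

text \<open>
  A request is accepted at state \<open>x\<close> if neither the trade nor any noise trade that may follow
  it exhausts the reserves. The hidden account never runs dry, so it imposes no condition.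
\<close>

definition accepted :: "noise \<Rightarrow> real \<Rightarrow> request \<Rightarrow> bool" where
  "accepted N x r \<longleftrightarrow>
     valid_request r \<and> 0 < x + amount r \<and> (\<forall>\<eta>\<in>msupport (N r). 0 < x + amount r + \<eta>)"

text \<open>
  \<open>\<gamma> x \<Delta> D\<close> is the fee for the trade \<open>\<Delta>\<close> at state \<open>x\<close> under the noise trade distribution \<open>D\<close>.
\<close>

type_synonym fee = "real \<Rightarrow> real \<Rightarrow> real measure \<Rightarrow> real"

definition privacy_fee :: "noise \<Rightarrow> fee \<Rightarrow> bool" where
  "privacy_fee N \<gamma> \<longleftrightarrow>
     (\<forall>x>0. \<forall>r. accepted N x r \<longrightarrow> no_privacy r \<longrightarrow> \<gamma> x (amount r) (N r) = 0)"

definition noise_fee :: "(real \<times> real \<Rightarrow> real) \<Rightarrow> real \<Rightarrow> fee" where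
  "noise_fee f k x \<Delta> D =
     (LINT \<eta>|D. LBINT a=ereal (x + \<Delta> + \<eta>)..ereal (x + \<Delta>).
        (spot_price f k a - spot_price f k (x + \<Delta>)))"


section \<open>Truthfulness\<close>

text \<open>
  Strategies of a trader with exclusive access to the market maker. \<open>External q s\<close> sells \<open>q\<close>
  units of X (buys, if \<open>q < 0\<close>) on the external market and goes on with \<open>s\<close>. \<open>Request r \<sigma>\<close>
  submits \<open>r\<close> and goes on with \<open>\<sigma> x'\<close>, where \<open>x'\<close> is the observed state after the noise trade.
\<close>

datatype strategy =
    Stop
  | External real strategy
  | Request request "real \<Rightarrow> strategy"

text \<open>
  The expected final holdings of Y, where \<open>p\<close> is the true price, \<open>x\<close> the state of the
  market maker, and \<open>h\<^sub>X\<close>, \<open>h\<^sub>Y\<close> are the current holdings of the trader.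
\<close>

primrec expected_Y ::
  "(real \<times> real \<Rightarrow> real) \<Rightarrow> real \<Rightarrow> noise \<Rightarrow> fee \<Rightarrow> real \<Rightarrow> strategy \<Rightarrow> real \<Rightarrow> real \<Rightarrow> real \<Rightarrow> real"
where
  "expected_Y f k N \<gamma> p Stop = (\<lambda>x h\<^sub>X h\<^sub>Y. h\<^sub>Y)"
| "expected_Y f k N \<gamma> p (External q s) =
     (\<lambda>x h\<^sub>X h\<^sub>Y. expected_Y f k N \<gamma> p s x (h\<^sub>X - q) (h\<^sub>Y + p * q))"
| "expected_Y f k N \<gamma> p (Request r \<sigma>) =
     (\<lambda>x h\<^sub>X h\<^sub>Y. LINT \<eta>|N r.
        expected_Y f k N \<gamma> p (\<sigma> (x + amount r + \<eta>)) (x + amount r + \<eta>)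
          (h\<^sub>X - amount r)
          (h\<^sub>Y + (reserve_Y f k x - reserve_Y f k (x + amount r)) - \<gamma> x (amount r) (N r)))"

text \<open>
  A strategy is admissible if all its requests are accepted, its expectations exist, and
  no short position in X remains at the end. Holdings in between may be negative: the trader is
  not constrained by a budget.
\<close>

primrec admissible ::
  "(real \<times> real \<Rightarrow> real) \<Rightarrow> real \<Rightarrow> noise \<Rightarrow> fee \<Rightarrow> real \<Rightarrow> strategy \<Rightarrow> real \<Rightarrow> real \<Rightarrow> real \<Rightarrow> bool"
where
  "admissible f k N \<gamma> p Stop = (\<lambda>x h\<^sub>X h\<^sub>Y. 0 \<le> h\<^sub>X)"
| "admissible f k N \<gamma> p (External q s) =
     (\<lambda>x h\<^sub>X h\<^sub>Y. admissible f k N \<gamma> p s x (h\<^sub>X - q) (h\<^sub>Y + p * q))"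
| "admissible f k N \<gamma> p (Request r \<sigma>) =
     (\<lambda>x h\<^sub>X h\<^sub>Y.
        let h\<^sub>X' = h\<^sub>X - amount r;
            h\<^sub>Y' = h\<^sub>Y + (reserve_Y f k x - reserve_Y f k (x + amount r)) - \<gamma> x (amount r) (N r)
        in accepted N x r \<and>
           (\<forall>\<eta>\<in>msupport (N r).
              admissible f k N \<gamma> p (\<sigma> (x + amount r + \<eta>)) (x + amount r + \<eta>) h\<^sub>X' h\<^sub>Y') \<and>
           integrable (N r) (\<lambda>\<eta>.
              expected_Y f k N \<gamma> p (\<sigma> (x + amount r + \<eta>)) (x + amount r + \<eta>) h\<^sub>X' h\<^sub>Y'))"

text \<open>
  A single trade with the market maker, with privacy level \<open>\<infinity>\<close> and masking interval \<open>[l, u]\<close>,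
  taking it from state \<open>x\<close> to state \<open>x'\<close>; the resulting holdings of X are then converted into Y
  on the external market.
\<close>

definition single_trade :: "real \<Rightarrow> real \<Rightarrow> real \<Rightarrow> real \<Rightarrow> real \<Rightarrow> strategy" where
  "single_trade l u x h\<^sub>X x' =
     Request \<lparr>amount = x' - x, mask_lo = l, mask_hi = u, privacy = \<infinity>\<rparr>
       (\<lambda>_. External (h\<^sub>X - (x' - x)) Stop)"

text \<open>
  Utilities are strictly increasing functions \<open>U\<close> of the expected final amount of Y. With the
  expectation of \<open>U\<close> of the final amount instead, the noise fee would not deter a risk-loving
  trader from adding noise. The true price is a spot price of the post-trade state in the sense
  that it is one of the subgradients where \<open>f\<close> is not differentiable.
\<close>

definition truthful :: "(real \<times> real \<Rightarrow> real) \<Rightarrow> real \<Rightarrow> noise \<Rightarrow> fee \<Rightarrow> bool" where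
  "truthful f k N \<gamma> \<longleftrightarrow>
     (\<forall>p>0.
        (\<exists>x'>0. p \<in> spot_prices f x' (reserve_Y f k x')) \<and>
        (\<forall>U::real \<Rightarrow> real. \<forall>x>0. \<forall>h\<^sub>X\<ge>0. \<forall>h\<^sub>Y\<ge>0. \<forall>x'>0. \<forall>l u.
           strict_mono U \<longrightarrow>
           p \<in> spot_prices f x' (reserve_Y f k x') \<longrightarrow>
           x' - x \<in> {l..u} \<longrightarrow>
           admissible f k N \<gamma> p (single_trade l u x h\<^sub>X x') x h\<^sub>X h\<^sub>Y \<and>
           (\<forall>s. admissible f k N \<gamma> p s x h\<^sub>X h\<^sub>Y \<longrightarrow>
              U (expected_Y f k N \<gamma> p s x h\<^sub>X h\<^sub>Y)
                \<le> U (expected_Y f k N \<gamma> p (single_trade l u x h\<^sub>X x') x h\<^sub>X h\<^sub>Y))))"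

end

theory Submission
  imports Defs
begin

text \<open>
  The level curve \<open>y = Y x\<close> is convex, and the spot prices at \<open>x\<close> are the negated subgradients of
  \<open>Y\<close> there; hence \<open>P\<close> integrates to decrements of \<open>Y\<close>, and for zero-mean noise the noise fee
  after a trade to state \<open>z\<close> is \<open>E (Y (z + \<eta>)) - Y z\<close>. At true price \<open>p\<close>, the most that can be
  extracted from the market maker in state \<open>x\<close> is \<open>V x = p * x + Y x - min (p * x' + Y x')\<close>, by a
  single trade to a state with spot price \<open>p\<close>. A noise trade raises \<open>V\<close> by exactly the noise fee on
  average. So charging the noise fee makes noise worthless to the trader, and charging less makes it
  profitable to ask for privacy and to arbitrage the resulting state.
\<close>

section \<open>Noise laws and interval integrals\<close>

text \<open>As a union of open null balls, the complement is visibly open, and Lindelof can thin it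
  out to countably many null sets.\<close>

lemma msupport_altdef:
  "- msupport D = \<Union>{ball \<eta> e |\<eta> e. 0 < e \<and> emeasure D (ball \<eta> e) = 0}"
  if "sets D = sets borel"
proof (intro equalityI subsetI)
  fix x assume "x \<in> - msupport D"
  then obtain e where "e > 0" "emeasure D (ball x e) = 0"
    unfolding msupport_def by (auto simp: zero_less_iff_neq_zero)
  then show "x \<in> \<Union>{ball \<eta> e |\<eta> e. 0 < e \<and> emeasure D (ball \<eta> e) = 0}"
    by (intro UnionI[of "ball x e"]) auto
next
  fix x assume "x \<in> \<Union>{ball \<eta> e |\<eta> e. 0 < e \<and> emeasure D (ball \<eta> e) = 0}"
  then obtain \<eta> e where \<eta>: "x \<in> ball \<eta> e" "emeasure D (ball \<eta> e) = 0"
    by auto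
  then obtain d where d: "d > 0" "ball x d \<subseteq> ball \<eta> e"
    by (meson open_ball open_contains_ball)
  have "emeasure D (ball x d) \<le> emeasure D (ball \<eta> e)"
    by (rule emeasure_mono) (use d that in auto)
  then show "x \<in> - msupport D"
    using \<eta> d by (auto simp: msupport_def)
qed

lemma closed_msupport: "sets D = sets borel \<Longrightarrow> closed (msupport D)"
  unfolding closed_def msupport_altdef by auto

lemma AE_msupport:
  assumes "sets D = sets borel"
  shows "AE \<eta> in D. \<eta> \<in> msupport D"
proof -
  let ?F = "{ball \<eta> e |\<eta> e. 0 < e \<and> emeasure D (ball \<eta> e) = 0}"
  obtain F' where F': "F' \<subseteq> ?F" "countable F'" "\<Union>F' = \<Union>?F"
    using Lindelof[of ?F] by auto
  have "\<Union>?F \<in> null_sets D"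
    unfolding F'(3)[symmetric] using F' assms
    by (intro null_sets_UN'[where N = "\<lambda>x. x", simplified]) (auto intro!: null_setsI)
  then show ?thesis
    unfolding msupport_altdef[OF assms, symmetric]
    by (rule AE_I') auto
qed

lemma msupport_return: "msupport (return borel x) = {x}"
  for x :: real
proof -
  have "(\<forall>e>0. x \<in> ball \<eta> e) \<longleftrightarrow> \<eta> = x" for \<eta>
    by (metis centre_in_ball dist_commute dist_nz less_irrefl mem_ball)
  then show ?thesis
    by (auto simp: msupport_def zero_less_iff_neq_zero indicator_eq_0_iff)
qed

text \<open>The spot price is junk, and possibly not measurable, on the negative half-line. The integral is
  still measurable in \<open>s\<close>: below the threshold up to which \<open>g\<close> is integrable it is a difference of
  two monotone functions, and above the threshold it is \<open>0\<close>.\<close>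

lemma borel_measurable_set_integral_mono_family:
  fixes h :: "real \<Rightarrow> 'a set" and g :: "'a \<Rightarrow> real"
  assumes "mono h" and h: "\<And>s. h s \<in> sets M"
  shows "(\<lambda>s. LINT x:h s|M. g x) \<in> borel_measurable borel"
proof -
  define A where "A = {s. set_integrable M (h s) g}"
  have A_down: "s \<in> A" if "t \<in> A" "s \<le> t" for s t
    using that set_integrable_subset[of M "h t" g "h s"] h monoD[OF \<open>mono h\<close>]
    by (auto simp: A_def)
  \<comment> \<open>\<open>A\<close> is closed downwards, so minus its indicator is increasing and
    hence Borel.\<close>
  have "(\<lambda>s. - indicator A s :: real) \<in> borel_measurable borel"
    using A_down by (intro borel_measurable_mono monoI) (auto simp: indicator_def)
  then have "(indicator A :: real \<Rightarrow> real) \<in> borel_measurable borel"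
    by simp
  then have A: "A \<in> sets borel"
    by (simp add: borel_measurable_indicator_iff)
  define I where "I q s = (LINT x:h s|M. max 0 (q * g x))" for q s
  have int: "set_integrable M (h s) (\<lambda>x. max 0 (q * g x))" if "s \<in> A" for s q
  proof -
    have "integrable M (\<lambda>x. max 0 (q * (indicator (h s) x *\<^sub>R g x)))"
      using that by (auto simp: A_def set_integrable_def)
    also have "(\<lambda>x. max 0 (q * (indicator (h s) x *\<^sub>R g x))) = (\<lambda>x. indicator (h s) x *\<^sub>R max 0 (q * g x))"
      by (auto simp: indicator_def)
    finally show ?thesis
      by (simp add: set_integrable_def)
  qed
  have "mono_on A (I q)" for q
    unfolding I_def set_lebesgue_integral_def
  proof (intro mono_onI integral_mono)
    fix s t x assume "s \<in> A" "t \<in> A" "s \<le> t"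
    then show "indicator (h s) x *\<^sub>R max 0 (q * g x) \<le> indicator (h t) x *\<^sub>R max 0 (q * g x)"
      using monoD[OF \<open>mono h\<close>, of s t] by (auto simp: indicator_def)
  qed (use int in \<open>auto simp: set_integrable_def\<close>)
  then have "I q \<in> borel_measurable (restrict_space borel A)" for q
    by (rule borel_measurable_mono_on_fnc)
  then have "(\<lambda>s. I 1 s - I (-1) s) \<in> borel_measurable (restrict_space borel A)"
    by (intro borel_measurable_diff)
  then have "(\<lambda>s. indicator A s *\<^sub>R (I 1 s - I (-1) s)) \<in> borel_measurable borel"
    using A by (subst (asm) borel_measurable_restrict_space_iff) auto
  also have "(\<lambda>s. indicator A s *\<^sub>R (I 1 s - I (-1) s)) = (\<lambda>s. LINT x:h s|M. g x)"
  proof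
    fix s
    show "indicator A s *\<^sub>R (I 1 s - I (-1) s) = (LINT x:h s|M. g x)"
    proof (cases "s \<in> A")
      case True
      have "I 1 s - I (-1) s = (LINT x:h s|M. max 0 (1 * g x) - max 0 (-1 * g x))"
        unfolding I_def by (rule set_integral_diff(2)[OF int int, OF True True, symmetric])
      also have "\<dots> = (LINT x:h s|M. g x)"
        by (intro arg_cong[where f = "set_lebesgue_integral M (h s)"]) auto
      finally show ?thesis
        using True by simp
    next
      case False
      then show ?thesis
        by (auto simp: A_def set_integrable_def set_lebesgue_integral_def not_integrable_integral_eq)
    qed
  qed
  finally show ?thesis .
qed

lemma borel_measurable_interval_integral:
  fixes g :: "real \<Rightarrow> real"
  shows "(\<lambda>s. LBINT a=ereal s..ereal z. g a) \<in> borel_measurable borel"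
proof -
  \<comment> \<open>With \<open>-s\<close> as left endpoint the interval grows with
    \<open>s\<close>, as the monotone family requires.\<close>
  have "(\<lambda>s. LBINT a:{-s<..<z}. g a) \<in> borel_measurable borel"
    by (rule borel_measurable_set_integral_mono_family) (auto simp: mono_def)
  from measurable_compose[OF borel_measurable_uminus[OF measurable_ident] this]
  have "(\<lambda>s. LBINT a:{s<..<z}. g a) \<in> borel_measurable borel"
    by simp
  moreover have "(\<lambda>s. LBINT a:{z<..<s}. g a) \<in> borel_measurable borel"
    by (rule borel_measurable_set_integral_mono_family) (auto simp: mono_def)
  ultimately show ?thesis
    unfolding interval_lebesgue_integral_def einterval_eq by measurable
qed

text \<open>The increments of \<open>F - G\<close> over \<open>s \<le> t\<close> are at most
  \<open>(P s - P t) * (t - s)\<close>. Over \<open>n\<close> equal pieces these bounds telescope to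
  \<open>(P a - P b) * (b - a) / n\<close>, which tends to \<open>0\<close>. Neither continuity nor
  differentiability enters.\<close>

lemma increments_eq_of_squeeze:
  fixes F G P :: "real \<Rightarrow> real"
  assumes "a \<le> b"
    and F: "\<And>s t. a \<le> s \<Longrightarrow> s \<le> t \<Longrightarrow> t \<le> b \<Longrightarrow> F s - F t \<in> {P t * (t - s)..P s * (t - s)}"
    and G: "\<And>s t. a \<le> s \<Longrightarrow> s \<le> t \<Longrightarrow> t \<le> b \<Longrightarrow> G s - G t \<in> {P t * (t - s)..P s * (t - s)}"
  shows "F a - F b = G a - G b"
proof -
  define H where "H s = F s - G s" for s
  have H: "\<bar>H s - H t\<bar> \<le> (P s - P t) * (t - s)" if "a \<le> s" "s \<le> t" "t \<le> b" for s t
    using F[OF that] G[OF that] by (auto simp: H_def algebra_simps abs_le_iff)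
  have bound: "real n * \<bar>H a - H b\<bar> \<le> (P a - P b) * (b - a)" if "n > 0" for n
  proof -
    define d where "d = (b - a) / real n"
    define t where "t i = a + real i * d" for i
    have d: "d \<ge> 0" "real n * d = b - a"
      using \<open>a \<le> b\<close> \<open>n > 0\<close> by (auto simp: d_def)
    have t: "t 0 = a" "t n = b" "t (Suc i) - t i = d" for i
      using d by (auto simp: t_def algebra_simps)
    have t_le: "t i \<le> b" if "i \<le> n" for i
      using mult_right_mono[of "real i" "real n" d] that d by (auto simp: t_def)
    have "\<bar>H a - H b\<bar> = \<bar>\<Sum>i<n. H (t i) - H (t (Suc i))\<bar>"
      using t by (simp add: sum_lessThan_telescope'[of "\<lambda>i. H (t i)"])
    also have "\<dots> \<le> (\<Sum>i<n. \<bar>H (t i) - H (t (Suc i))\<bar>)"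
      by (rule sum_abs)
    also have "\<dots> \<le> (\<Sum>i<n. (P (t i) - P (t (Suc i))) * d)"
    proof (rule sum_mono)
      fix i assume "i \<in> {..<n}"
      then show "\<bar>H (t i) - H (t (Suc i))\<bar> \<le> (P (t i) - P (t (Suc i))) * d"
        using H[of "t i" "t (Suc i)"] t(3)[of i] t_le[of "Suc i"] d by (auto simp: t_def)
    qed
    also have "\<dots> = (P a - P b) * d"
      using t by (simp add: sum_lessThan_telescope'[of "\<lambda>i. P (t i)"] flip: sum_distrib_right)
    finally have "real n * \<bar>H a - H b\<bar> \<le> real n * ((P a - P b) * d)"
      using \<open>n > 0\<close> by simp
    then show ?thesis
      using d by (metis mult.left_commute)
  qed
  have "\<bar>H a - H b\<bar> = 0"
  proof (rule ccontr)
    assume "\<bar>H a - H b\<bar> \<noteq> 0"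
    then obtain n where "(P a - P b) * (b - a) < real n * \<bar>H a - H b\<bar>"
      using reals_Archimedean3[of "\<bar>H a - H b\<bar>"] by auto
    \<comment> \<open>For \<open>n = 0\<close> the choice of \<open>n\<close> would make
      \<open>(P a - P b) * (b - a)\<close> negative, against the bound for one piece.\<close>
    moreover from this have "n > 0"
      using bound[of 1] by (intro Nat.gr0I) auto
    ultimately show False
      using bound[of n] by simp
  qed
  then show ?thesis
    by (simp add: H_def)
qed

section \<open>The level curve and its spot prices\<close>

locale level_curve =
  fixes f :: "real \<times> real \<Rightarrow> real" and k :: real
  assumes cfmm: "cfmm f k"
begin

abbreviation Y :: "real \<Rightarrow> real" where "Y \<equiv> reserve_Y f k"
abbreviation P :: "real \<Rightarrow> real" where "P \<equiv> spot_price f k"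

section \<open>The level curve as a convex graph, and its supporting lines\<close>

lemma f_mono: "0 \<le> x \<Longrightarrow> x \<le> x' \<Longrightarrow> 0 \<le> y \<Longrightarrow> y \<le> y' \<Longrightarrow> f (x, y) \<le> f (x', y')"
  using cfmm by (simp add: cfmm_def trading_function_def)

lemma P_antimono: "0 < x \<Longrightarrow> x \<le> x' \<Longrightarrow> P x' \<le> P x"
  using cfmm by (auto simp: cfmm_def monotone_on_def)

lemma Y_unique:
  assumes "0 < x"
  shows "\<exists>!y. 0 < y \<and> f (x, y) = k"
  using cfmm assms by (auto simp: cfmm_def)

lemma Y_pos: "0 < x \<Longrightarrow> 0 < Y x"
  and f_Y: "0 < x \<Longrightarrow> f (x, Y x) = k"
  using theI'[OF Y_unique] by (auto simp: reserve_Y_def)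

lemma Y_eqI: "0 < x \<Longrightarrow> 0 < y \<Longrightarrow> f (x, y) = k \<Longrightarrow> Y x = y"
  using Y_unique Y_pos f_Y by blast

text \<open>Below \<open>Y x\<close> the value cannot reach \<open>k\<close>: by monotonicity
  \<open>f\<close> would be constantly \<open>k\<close> up to \<open>Y x\<close>, against
  uniqueness.\<close>

lemma upper_level_iff:
  assumes "0 < x" "0 \<le> y"
  shows "k \<le> f (x, y) \<longleftrightarrow> Y x \<le> y"
proof
  assume k: "k \<le> f (x, y)"
  show "Y x \<le> y"
  proof (rule ccontr)
    assume y: "\<not> Y x \<le> y"
    \<comment> \<open>The midpoint is taken because \<open>y\<close> may be \<open>0\<close>, while
      uniqueness concerns positive amounts only.\<close>
    define y' where "y' = (y + Y x) / 2"
    have y': "0 < y'" "y \<le> y'" "y' < Y x"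
      using y assms Y_pos[of x] by (auto simp: y'_def)
    have "f (x, y') = k"
      using f_mono[of x x y y'] f_mono[of x x y' "Y x"] f_Y[of x] k y' assms by simp
    then show False
      using Y_eqI[of x y'] y' assms by simp
  qed
next
  assume "Y x \<le> y"
  then show "k \<le> f (x, y)"
    using f_mono[of x x "Y x" y] f_Y[of x] Y_pos[of x] assms by simp
qed

lemma Y_antimono:
  assumes "0 < x" "x \<le> x'"
  shows "Y x' \<le> Y x"
  using assms f_mono[of x x' "Y x" "Y x"] f_Y[of x] Y_pos[of x] upper_level_iff[of x' "Y x"] by simp

text \<open>Over positive \<open>x\<close>, the upper level set, convex by quasi-concavity, is the
  epigraph of \<open>Y\<close>.\<close>

lemma Y_convex: "convex_on {0<..} Y"
proof (rule convex_onI)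
  fix t x x' :: real
  assume t: "0 < t" "t < 1" and x: "x \<in> {0<..}" "x' \<in> {0<..}"
  let ?L = "{s \<in> nonneg_quadrant. k \<le> f s}"
  have "convex ?L"
    using cfmm by (auto simp: cfmm_def trading_function_def quasi_concave_on_def)
  moreover have "(x, Y x) \<in> ?L" "(x', Y x') \<in> ?L"
    using x f_Y[of x] f_Y[of x'] Y_pos[of x] Y_pos[of x'] by (auto simp: nonneg_quadrant_def)
  ultimately have "(1 - t) *\<^sub>R (x, Y x) + t *\<^sub>R (x', Y x') \<in> ?L"
    using t by (intro convexD) auto
  moreover have "0 < (1 - t) * x + t * x'"
    using t x by (simp add: add_pos_pos)
  ultimately show "Y ((1 - t) *\<^sub>R x + t *\<^sub>R x') \<le> (1 - t) * Y x + t * Y x'"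
    by (auto simp: nonneg_quadrant_def upper_level_iff)
qed auto

lemma Y_continuous: "continuous_on {0<..} Y"
  by (rule convex_on_continuous[OF _ Y_convex]) auto

text \<open>Supporting the epigraph is the same as supporting its graph, so \<open>p\<close>
  qualifies iff \<open>-p\<close> is a subgradient of the convex \<open>Y\<close>.\<close>

lemma quasi_subgradient_price_iff:
  assumes "0 < x"
  shows "quasi_subgradient_price f x (Y x) p \<longleftrightarrow> (\<forall>x'>0. p * x + Y x \<le> p * x' + Y x')"
proof
  assume q: "quasi_subgradient_price f x (Y x) p"
  show "\<forall>x'>0. p * x + Y x \<le> p * x' + Y x'"
  proof (intro allI impI)
    fix x' :: real assume "0 < x'"
    then have "(x', Y x') \<in> nonneg_quadrant" "f (x, Y x) \<le> f (x', Y x')"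
      using f_Y[of x] f_Y[of x'] Y_pos[of x'] assms by (auto simp: nonneg_quadrant_def)
    then show "p * x + Y x \<le> p * x' + Y x'"
      using q by (auto simp: quasi_subgradient_price_def)
  qed
next
  assume *: "\<forall>x'>0. p * x + Y x \<le> p * x' + Y x'"
  have pos: "p * x + Y x \<le> p * x' + y'" if "0 < x'" "0 \<le> y'" "k \<le> f (x', y')" for x' y'
    using *[rule_format, of x'] upper_level_iff[of x' y'] that by simp
  \<comment> \<open>\<open>Y\<close> says nothing at \<open>x' = 0\<close>. Moving right stays in
    the upper level set, and the inequality passes to the limit.\<close>
  have "p * x + Y x \<le> p * x' + y'" if x': "0 \<le> x'" "0 \<le> y'" "k \<le> f (x', y')" for x' y'
  proof (rule tendsto_lowerbound)
    show "((\<lambda>t. p * t + y') \<longlongrightarrow> p * x' + y') (at_right x')"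
      by (intro tendsto_intros)
    show "\<forall>\<^sub>F t in at_right x'. p * x + Y x \<le> p * t + y'"
      unfolding eventually_at_right_field
    proof (intro exI[of _ "x' + 1"] conjI allI impI)
      fix t assume "x' < t"
      then show "p * x + Y x \<le> p * t + y'"
        using pos[of t y'] f_mono[of x' t y' y'] x' by auto
    qed auto
  qed auto
  then show "quasi_subgradient_price f x (Y x) p"
    using f_Y[OF assms] by (auto simp: quasi_subgradient_price_def nonneg_quadrant_def)
qed

lemma subgradient_exists:
  assumes "0 < x"
  shows "\<exists>p. \<forall>x'>0. p * x + Y x \<le> p * x' + Y x'"
proof -
  \<comment> \<open>The infimum of the chord slopes to the right is the right-hand derivative of
    \<open>Y\<close>.\<close>
  define q where "q = Inf ((\<lambda>t. (Y x - Y t) / (x - t)) ` ({x<..} \<inter> {0<..}))"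
  have "Y x' \<ge> Y x + q * (x' - x)" if "0 < x'" for x'
    unfolding q_def
    by (rule convex_le_Inf_differential[OF Y_convex]) (use that assms in \<open>auto simp: interior_open\<close>)
  then show ?thesis
    by (intro exI[of _ "- q"]) (auto simp: algebra_simps)
qed

text \<open>Along the tangent of slope \<open>- p\<close>, which lies below the level curve, \<open>f\<close> has a maximum at
  \<open>x\<close>; so its directional derivative vanishes there.\<close>

lemma subgradient_eq_quotient:
  assumes x: "0 < x" and "f differentiable (at (x, Y x))"
    and "deriv (\<lambda>t. f (x, t)) (Y x) \<noteq> 0"
    and p: "\<forall>x'>0. p * x + Y x \<le> p * x' + Y x'"
  shows "deriv (\<lambda>t. f (t, Y x)) x / deriv (\<lambda>t. f (x, t)) (Y x) = p"
proof -
  obtain F where F: "(f has_derivative F) (at (x, Y x))"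
    using assms by (auto simp: differentiable_def)
  then interpret F: bounded_linear F
    by (rule has_derivative_bounded_linear)
  have F_eq: "F (a, b) = a * F (1, 0) + b * F (0, 1)" for a b
    using F.add[of "a *\<^sub>R (1, 0)" "b *\<^sub>R (0, 1)"] F.scaleR[of a "(1, 0)"] F.scaleR[of b "(0, 1)"]
    by simp
  \<comment> \<open>The base point \<open>c\<close> is free so that both partial derivatives and the
    tangent direction are instances.\<close>
  have dir: "((\<lambda>t. f (x + a * (t - c), Y x + b * (t - c))) has_field_derivative
      a * F (1, 0) + b * F (0, 1)) (at c)" for a b c
  proof -
    have "((\<lambda>t. (x + a * (t - c), Y x + b * (t - c))) has_derivative (\<lambda>h. (a * h, b * h))) (at c)"
      by (auto intro!: derivative_eq_intros)
    from has_derivative_compose[OF this, of f F] F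
    have "((\<lambda>t. f (x + a * (t - c), Y x + b * (t - c))) has_derivative (\<lambda>h. F (a * h, b * h))) (at c)"
      by simp
    also have "(\<lambda>h. F (a * h, b * h)) = (*) (a * F (1, 0) + b * F (0, 1))"
      by (intro ext) (subst F_eq, simp add: algebra_simps)
    finally show ?thesis
      unfolding has_field_derivative_def .
  qed
  have fx: "deriv (\<lambda>t. f (t, Y x)) x = F (1, 0)"
    using dir[of 1 x 0] by (intro DERIV_imp_deriv) simp
  have fy: "deriv (\<lambda>t. f (x, t)) (Y x) = F (0, 1)"
    using dir[of 0 "Y x" 1] by (intro DERIV_imp_deriv) simp
  define g where "g t = f (x + 1 * (t - x), Y x + (- p) * (t - x))" for t
  have "isCont (\<lambda>t. Y x - p * (t - x)) x"
    by (intro continuous_intros)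
  then have "\<forall>\<^sub>F t in at x. 0 < Y x - p * (t - x)"
    using Y_pos[OF x] by (intro order_tendstoD(1)) (auto simp: isCont_def)
  moreover have "\<forall>\<^sub>F t in at x. 0 < t"
    using x by (intro order_tendstoD(1)[OF tendsto_ident_at])
  ultimately have "\<forall>\<^sub>F t in at x. g t \<le> g x"
  proof eventually_elim
    case (elim t)
    have "Y x - p * (t - x) \<le> Y t"
      using p[rule_format, of t] elim by (simp add: algebra_simps)
    then have "g t \<le> f (t, Y t)"
      unfolding g_def using elim by (auto intro!: f_mono)
    also have "\<dots> = g x"
      using elim x by (simp add: g_def f_Y)
    finally show ?case .
  qed
  then obtain d where "d > 0" "\<And>t. t \<noteq> x \<Longrightarrow> dist t x < d \<Longrightarrow> g t \<le> g x"
    by (auto simp: eventually_at)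
  then have "\<forall>t. \<bar>x - t\<bar> < d \<longrightarrow> g t \<le> g x"
    by (metis dist_commute dist_real_def order_refl)
  moreover have "DERIV g x :> 1 * F (1, 0) + (- p) * F (0, 1)"
    unfolding g_def by (rule dir)
  ultimately have "1 * F (1, 0) + (- p) * F (0, 1) = 0"
    using DERIV_local_max \<open>d > 0\<close> by blast
  then show ?thesis
    using assms(3) by (simp add: fx fy field_simps)
qed

text \<open>Where the quotient is meaningful, a subgradient exists and each one equals the quotient,
  so both branches of the definition describe the same set.\<close>

lemma spot_prices_eq:
  assumes "0 < x"
  shows "spot_prices f x (Y x) = {p. \<forall>x'>0. p * x + Y x \<le> p * x' + Y x'}"
proof (cases "f differentiable (at (x, Y x)) \<and> deriv (\<lambda>t. f (x, t)) (Y x) \<noteq> 0")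
  case True
  then show ?thesis
    using subgradient_exists[OF assms] subgradient_eq_quotient[OF assms]
    by (auto simp: spot_prices_def)
next
  case False
  then show ?thesis
    by (simp only: spot_prices_def if_False quasi_subgradient_price_iff[OF assms])
qed

text \<open>The supremum defining \<open>P\<close> is attained: the subgradient prices form a
  nonempty closed set, bounded above by comparison with \<open>x / 2\<close>.\<close>

lemma P_subgradient:
  assumes x: "0 < x" and "0 < x'"
  shows "P x * x + Y x \<le> P x * x' + Y x'"
proof -
  let ?S = "{p. \<forall>x'>0. p * x + Y x \<le> p * x' + Y x'}"
  have "p \<le> (Y (x / 2) - Y x) / (x / 2)" if "p \<in> ?S" for p
  proof -
    have "p * x + Y x \<le> p * (x / 2) + Y (x / 2)"
      using that[unfolded mem_Collect_eq, rule_format, of "x / 2"] x by simp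
    then show ?thesis
      using x by (simp add: field_simps)
  qed
  then have "bdd_above ?S"
    by (rule bdd_aboveI)
  moreover have "closed ?S"
  proof -
    have "?S = (\<Inter>x'\<in>{0<..}. {p. p * x + Y x \<le> p * x' + Y x'})"
      by auto
    also have "closed \<dots>"
      by (intro closed_INT ballI closed_Collect_le continuous_intros)
    finally show ?thesis .
  qed
  ultimately have "Sup ?S \<in> ?S"
    using subgradient_exists[OF x] by (intro closed_contains_Sup) auto
  then show ?thesis
    using assms by (simp add: spot_price_def spot_prices_eq)
qed

text \<open>Such an \<open>x\<close> minimizes \<open>p * x + Y x\<close>. As \<open>P\<close>
  exceeds \<open>p\<close> at some \<open>a\<close> and is below \<open>p\<close> at some
  \<open>b\<close>, the supporting lines at \<open>a\<close> and \<open>b\<close> show that a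
  minimum over \<open>{a..b}\<close> is global.\<close>

lemma spot_price_attained:
  assumes "0 < p"
  shows "\<exists>x>0. p \<in> spot_prices f x (Y x)"
proof -
  have "\<forall>\<^sub>F x in at_right 0. p < P x"
    using cfmm by (auto simp: cfmm_def filterlim_at_top_dense)
  moreover have "\<forall>\<^sub>F x::real in at_right 0. 0 < x"
    by (rule eventually_at_right_less)
  ultimately have "\<forall>\<^sub>F x in at_right 0. 0 < x \<and> p < P x"
    by eventually_elim auto
  then obtain a where a: "0 < a" "p < P a"
    using eventually_happens[of _ "at_right (0::real)"] by auto
  have "\<forall>\<^sub>F x in at_top. P x < p"
    using cfmm assms by (intro order_tendstoD(2)) (auto simp: cfmm_def)
  then have "\<forall>\<^sub>F x in at_top. P x < p \<and> a \<le> x"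
    using eventually_ge_at_top[of a] by eventually_elim auto
  then obtain b where b: "P b < p" "a \<le> b"
    using eventually_happens[of _ "at_top :: real filter"] by auto
  have "continuous_on {a..b} (\<lambda>x. p * x + Y x)"
    using a by (intro continuous_intros continuous_on_subset[OF Y_continuous]) auto
  then obtain x where x: "x \<in> {a..b}" "\<And>t. t \<in> {a..b} \<Longrightarrow> p * x + Y x \<le> p * t + Y t"
    using continuous_attains_inf[of "{a..b}" "\<lambda>x. p * x + Y x"] b by auto
  have "p * x + Y x \<le> p * t + Y t" if "0 < t" for t
  proof -
    consider "t < a" | "t \<in> {a..b}" | "b < t"
      by fastforce
    then show ?thesis
    proof cases
      case 1
      have "p * (a - t) \<le> P a * (a - t)"
        using 1 a by (intro mult_right_mono) auto
      then show ?thesis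
        using P_subgradient[of a t] x(2)[of a] that a b by (simp add: algebra_simps)
    next
      case 2
      then show ?thesis by (rule x(2))
    next
      case 3
      have "P b * (t - b) \<le> p * (t - b)"
        using 3 b by (intro mult_right_mono) auto
      then show ?thesis
        using P_subgradient[of b t] x(2)[of b] that a b by (simp add: algebra_simps)
    qed
  qed
  then show ?thesis
    using x a by (intro exI[of _ x]) (auto simp: spot_prices_eq)
qed

section \<open>The integral of the spot price\<close>

lemma interval_integrable_P:
  assumes "0 < s" "0 < t"
  shows "interval_lebesgue_integrable lborel (ereal s) (ereal t) P"
proof -
  have *: "set_integrable lborel {a<..<b} P" if "0 < a" "a \<le> b" for a b
  proof -
    have "mono_on {a<..<b} (\<lambda>x. - P x)"
      using P_antimono that by (auto intro!: mono_onI)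
    then have "(\<lambda>x. - P x) \<in> borel_measurable (restrict_space borel {a<..<b})"
      by (rule borel_measurable_mono_on_fnc)
    then have "(\<lambda>x. indicator {a<..<b} x *\<^sub>R - P x) \<in> borel_measurable borel"
      by (subst (asm) borel_measurable_restrict_space_iff) auto
    then have P_measurable: "(\<lambda>x. indicator {a<..<b} x * P x) \<in> borel_measurable borel"
      by simp
    show ?thesis
      unfolding set_integrable_def
    proof (rule integrableI_bounded_set[where A = "{a<..<b}" and B = "max \<bar>P a\<bar> \<bar>P b\<bar>"])
      show "AE x in lborel. x \<in> {a<..<b} \<longrightarrow>
          norm (indicator {a<..<b} x *\<^sub>R P x) \<le> max \<bar>P a\<bar> \<bar>P b\<bar>"
      proof (intro AE_I2 impI)
        fix x assume "x \<in> {a<..<b}"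
        then show "norm (indicator {a<..<b} x *\<^sub>R P x) \<le> max \<bar>P a\<bar> \<bar>P b\<bar>"
          using P_antimono[of a x] P_antimono[of x b] that by auto
      qed
    qed (use that P_measurable in auto)
  qed
  show ?thesis
    using *[of s t] *[of t s] assms by (auto simp: interval_lebesgue_integrable_def)
qed

text \<open>Increments of \<open>Y\<close> are squeezed by the subgradient inequality and those of
  the integral by antitonicity of \<open>P\<close>, with the same bounds. So kinks of
  \<open>Y\<close> do no harm.\<close>

lemma integral_P:
  assumes "0 < s" "0 < z"
  shows "(LBINT a=ereal s..ereal z. P a) = Y s - Y z"
proof -
  have le: "(LBINT a=ereal s..ereal z. P a) = Y s - Y z" if "0 < s" "s \<le> z" for s z
  proof -
    define I where "I x = (LBINT a=ereal x..ereal z. P a)" for x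
    have I_diff: "I x - I t = (LBINT a=ereal x..ereal t. P a)" if "s \<le> x" "s \<le> t" for x t
    proof -
      have "(LBINT a=ereal x..ereal t. P a) + I t = I x"
        unfolding I_def using that \<open>0 < s\<close> \<open>s \<le> z\<close>
        by (intro interval_integral_sum) (auto simp: min_def max_def intro!: interval_integrable_P)
      then show ?thesis by simp
    qed
    have "I s - I z = Y s - Y z"
    proof (rule increments_eq_of_squeeze[OF \<open>s \<le> z\<close>, where P = P])
      fix x t assume xt: "s \<le> x" "x \<le> t" "t \<le> z"
      have P_int: "set_integrable lborel {x<..<t} P"
        using interval_integrable_P[of x t] xt \<open>0 < s\<close> by (simp add: interval_lebesgue_integrable_def)
      have const_int: "set_integrable lborel {x<..<t} (\<lambda>a. c)" for c :: real
        using interval_integral_const(1)[of x t c] xt by (simp add: interval_lebesgue_integrable_def)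
      have const: "(LBINT a:{x<..<t}. c) = c * (t - x)" for c :: real
        using interval_integral_const(2)[of x t c] xt by (simp add: interval_lebesgue_integral_def)
      have I: "I x - I t = (LBINT a:{x<..<t}. P a)"
        using I_diff[of x t] xt by (simp add: interval_lebesgue_integral_def)
      have "(LBINT a:{x<..<t}. P t) \<le> (LBINT a:{x<..<t}. P a)"
        using xt \<open>0 < s\<close> by (intro set_integral_mono P_int const_int P_antimono) auto
      moreover have "(LBINT a:{x<..<t}. P a) \<le> (LBINT a:{x<..<t}. P x)"
        using xt \<open>0 < s\<close> by (intro set_integral_mono P_int const_int P_antimono) auto
      ultimately show "I x - I t \<in> {P t * (t - x)..P x * (t - x)}"
        by (simp add: const I)
      show "Y x - Y t \<in> {P t * (t - x)..P x * (t - x)}"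
        using P_subgradient[of x t] P_subgradient[of t x] xt \<open>0 < s\<close> by (simp add: algebra_simps)
    qed
    moreover have "I z = 0"
      by (simp add: I_def)
    ultimately show ?thesis
      by (simp add: I_def)
  qed
  show ?thesis
    using le[of s z] le[of z s] assms interval_integral_endpoints_reverse[of "ereal s" "ereal z" P]
    by (cases "s \<le> z") auto
qed

lemma integral_P_minus_const:
  assumes "0 < s" "0 < z"
  shows "(LBINT a=ereal s..ereal z. (P a - c)) = Y s - Y z + c * (s - z)"
  using assms interval_integrable_P[of s z]
  by (simp add: integral_P interval_integral_const algebra_simps)

end

section \<open>The noise fee\<close>

locale noisy_market = level_curve +
  fixes N :: noise
  assumes noise_mechanism: "noise_mechanism N" and zero_mean: "zero_mean N"
begin

lemma N_no_privacy: "valid_request r \<Longrightarrow> no_privacy r \<Longrightarrow> N r = return borel 0"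
  using noise_mechanism by (auto simp: noise_mechanism_def)

context
  fixes x r
  assumes accepted: "accepted N x r"
begin

lemma valid: "valid_request r"
  using accepted by (simp add: accepted_def)

interpretation N: prob_space "N r"
  using noise_mechanism valid by (auto simp: noise_mechanism_def)

lemma sets_N [measurable_cong]: "sets (N r) = sets borel"
  using noise_mechanism valid by (auto simp: noise_mechanism_def)

lemma post_trade_pos: "0 < x + amount r"
  using accepted by (simp add: accepted_def)

text \<open>Acceptance makes the reserve positive at each point of the support; compactness turns
  this into a uniform margin.\<close>

lemma AE_noise:
  obtains m where "0 < m" "AE \<eta> in N r. m \<le> x + amount r + \<eta>"
proof (cases "msupport (N r) = {}")
  case True
  \<comment> \<open>With empty support every property holds almost everywhere, so any positive
    \<open>m\<close> serves.\<close>
  then show ?thesis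
    using that[of 1] AE_msupport[OF sets_N] by simp
next
  case False
  have "compact (msupport (N r))"
    using closed_msupport[OF sets_N] noise_mechanism valid
    by (simp add: compact_eq_bounded_closed noise_mechanism_def)
  then obtain \<eta>0 where "\<eta>0 \<in> msupport (N r)" "\<And>\<eta>. \<eta> \<in> msupport (N r) \<Longrightarrow> \<eta>0 \<le> \<eta>"
    using compact_attains_inf[OF _ False] by blast
  then have "0 < x + amount r + \<eta>0" "AE \<eta> in N r. x + amount r + \<eta>0 \<le> x + amount r + \<eta>"
    using accepted AE_msupport[OF sets_N] by (auto simp: accepted_def elim: eventually_mono)
  then show ?thesis
    by (rule that)
qed

lemma integrable_noise: "integrable (N r) (\<lambda>\<eta>. \<eta>)"
proof -
  obtain B where "\<And>\<eta>. \<eta> \<in> msupport (N r) \<Longrightarrow> norm \<eta> \<le> B"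
    using noise_mechanism valid unfolding noise_mechanism_def bounded_iff by blast
  then show ?thesis
    using AE_msupport[OF sets_N] by (intro N.integrable_const_bound[of _ B]) (auto elim: eventually_mono)
qed

lemma integral_noise: "(LINT \<eta>|N r. \<eta>) = 0"
  using zero_mean valid by (auto simp: zero_mean_def)

text \<open>The values of \<open>Y\<close> outside the positive half-line are junk, and need not be measurable.\<close>

lemma integrable_Y: "integrable (N r) (\<lambda>\<eta>. if 0 < x + amount r + \<eta> then Y (x + amount r + \<eta>) else 0)"
proof -
  obtain m where m: "0 < m" "AE \<eta> in N r. m \<le> x + amount r + \<eta>"
    by (rule AE_noise)
  have "(\<lambda>t. if t \<in> {0<..} then Y t else 0) \<in> borel_measurable borel"
    by (intro borel_measurable_continuous_on_if Y_continuous) auto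
  then have [measurable]: "(\<lambda>t. if 0 < t then Y t else 0) \<in> borel_measurable borel"
    by simp
  have "(\<lambda>\<eta>. (\<lambda>t. if 0 < t then Y t else 0) (x + amount r + \<eta>)) \<in> borel_measurable (N r)"
    by measurable
  moreover have "AE \<eta> in N r. norm (if 0 < x + amount r + \<eta> then Y (x + amount r + \<eta>) else 0) \<le> Y m"
    using m(2)
  proof eventually_elim
    case (elim \<eta>)
    then show ?case
      using m(1) Y_pos[of "x + amount r + \<eta>"] Y_antimono[of m "x + amount r + \<eta>"] by auto
  qed
  ultimately show ?thesis
    by (intro N.integrable_const_bound[of _ "Y m"]) auto
qed

text \<open>By \<open>AE_noise\<close> the guard changes the integrand only on a null set.\<close>

definition expected_reserve :: real where
  "expected_reserve = (LINT \<eta>|N r. (if 0 < x + amount r + \<eta> then Y (x + amount r + \<eta>) else 0))"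

text \<open>This shape covers the noise fee as well as the payoffs of strategies. The zero mean
  removes the term in \<open>q\<close>.\<close>

lemma integral_affine_Y:
  "integrable (N r) (\<lambda>\<eta>. c + q * \<eta> + (if 0 < x + amount r + \<eta> then Y (x + amount r + \<eta>) else 0))"
  "(LINT \<eta>|N r. c + q * \<eta> + (if 0 < x + amount r + \<eta> then Y (x + amount r + \<eta>) else 0)) =
    c + expected_reserve"
  using integrable_Y integrable_noise
  by (simp_all add: expected_reserve_def integral_noise N.prob_space)

text \<open>The constant is free: \<open>P (x + amount r)\<close> gives the noise fee and
  \<open>0\<close> its simplified form. The zero mean makes the value independent of
  \<open>c\<close>.\<close>

lemma integral_interval_integral_P:
  "(LINT \<eta>|N r. LBINT a=ereal (x + amount r + \<eta>)..ereal (x + amount r). (P a - c)) =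
    expected_reserve - Y (x + amount r)"
proof -
  let ?z = "x + amount r"
  obtain m where m: "0 < m" "AE \<eta> in N r. m \<le> ?z + \<eta>"
    by (rule AE_noise)
  have "(LINT \<eta>|N r. LBINT a=ereal (?z + \<eta>)..ereal ?z. (P a - c)) =
      (LINT \<eta>|N r. - Y ?z + c * \<eta> + (if 0 < ?z + \<eta> then Y (?z + \<eta>) else 0))"
  proof (rule integral_cong_AE)
    show "(\<lambda>\<eta>. LBINT a=ereal (?z + \<eta>)..ereal ?z. (P a - c)) \<in> borel_measurable (N r)"
      using measurable_compose[OF _ borel_measurable_interval_integral, of "\<lambda>\<eta>. ?z + \<eta>" "N r" ?z]
      by simp
    show "AE \<eta> in N r. (LBINT a=ereal (?z + \<eta>)..ereal ?z. (P a - c)) =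
        - Y ?z + c * \<eta> + (if 0 < ?z + \<eta> then Y (?z + \<eta>) else 0)"
      using m(2)
    proof eventually_elim
      case (elim \<eta>)
      then show ?case
        using m(1) integral_P_minus_const[of "?z + \<eta>" ?z c] post_trade_pos by simp
    qed
  qed (rule borel_measurable_integrable[OF integral_affine_Y(1)])
  then show ?thesis
    unfolding integral_affine_Y by simp
qed

lemma noise_fee_eq: "noise_fee f k x (amount r) (N r) = expected_reserve - Y (x + amount r)"
  by (simp add: noise_fee_def integral_interval_integral_P)

lemma noise_fee_simplified:
  "noise_fee f k x (amount r) (N r) =
    (LINT \<eta>|N r. LBINT a=ereal (x + amount r + \<eta>)..ereal (x + amount r). P a)"
  using integral_interval_integral_P[of 0] by (simp add: noise_fee_eq)

end

lemma privacy_fee_noise_fee: "privacy_fee N (noise_fee f k)"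
  unfolding privacy_fee_def
proof (intro allI impI)
  fix x r assume "accepted N x r" "no_privacy r"
  then have "N r = return borel 0"
    by (auto intro: N_no_privacy valid)
  \<comment> \<open>For a measurable integrand, integration against the point mass is evaluation at
    \<open>0\<close>, where the two endpoints coincide.\<close>
  moreover have "(\<lambda>\<eta>. LBINT a=ereal (x + amount r + \<eta>)..ereal (x + amount r).
      (P a - P (x + amount r))) \<in> borel_measurable borel"
    by (rule measurable_compose[OF _ borel_measurable_interval_integral]) simp
  ultimately show "noise_fee f k x (amount r) (N r) = 0"
    by (simp add: noise_fee_def integral_return)
qed

subsection \<open>Truthfulness\<close>

text \<open>Without privacy the noise is a point mass at \<open>0\<close> and the fee vanishes. The
  fee is left general because the minimality argument needs it for an arbitrary truthful
  one.\<close>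

lemma single_trade_value:
  assumes "0 < x" "0 < x'" "x' - x \<in> {l..u}" "privacy_fee N \<gamma>"
  shows "admissible f k N \<gamma> p (single_trade l u x h\<^sub>X x') x h\<^sub>X h\<^sub>Y"
    and "expected_Y f k N \<gamma> p (single_trade l u x h\<^sub>X x') x h\<^sub>X h\<^sub>Y =
      h\<^sub>Y + (Y x - Y x') + p * (h\<^sub>X - (x' - x))"
proof -
  define r where "r = \<lparr>amount = x' - x, mask_lo = l, mask_hi = u, privacy = \<infinity>\<rparr>"
  have amount: "amount r = x' - x"
    by (simp add: r_def)
  have "valid_request r" "no_privacy r"
    using assms by (auto simp: r_def valid_request_def no_privacy_def)
  then have N: "N r = return borel 0"
    by (rule N_no_privacy)
  then have acc: "accepted N x r"
    using \<open>valid_request r\<close> assms by (simp add: accepted_def amount msupport_return)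
  have \<gamma>: "\<gamma> x (x' - x) (N r) = 0"
    using assms acc \<open>no_privacy r\<close> unfolding privacy_fee_def amount[symmetric] by blast
  have trade: "single_trade l u x h\<^sub>X x' = Request r (\<lambda>_. External (h\<^sub>X - (x' - x)) Stop)"
    by (simp add: single_trade_def r_def)
  interpret N: prob_space "N r"
    unfolding N by (rule prob_space_return) simp
  show "expected_Y f k N \<gamma> p (single_trade l u x h\<^sub>X x') x h\<^sub>X h\<^sub>Y =
      h\<^sub>Y + (Y x - Y x') + p * (h\<^sub>X - (x' - x))"
    unfolding trade by (simp add: \<gamma> amount N.prob_space)
  show "admissible f k N \<gamma> p (single_trade l u x h\<^sub>X x') x h\<^sub>X h\<^sub>Y"
    unfolding trade using acc by (simp add: \<gamma> amount)
qed

text \<open>The bound is the value of all holdings at the true price, plus the gain from arbitraging the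
  market maker to the state \<open>x'\<close>. External trades leave it unchanged, and requests leave it
  unchanged on average.\<close>

lemma expected_Y_le:
  assumes "0 < p" "0 < x'" and x': "p \<in> spot_prices f x' (Y x')"
    and "0 < x" "admissible f k N (noise_fee f k) p s x h\<^sub>X h\<^sub>Y"
  shows "expected_Y f k N (noise_fee f k) p s x h\<^sub>X h\<^sub>Y \<le>
    h\<^sub>Y + p * h\<^sub>X + (p * x + Y x) - (p * x' + Y x')"
  using assms(4,5)
proof (induction s arbitrary: x h\<^sub>X h\<^sub>Y)
  case Stop
  \<comment> \<open>\<open>x'\<close> minimizes \<open>p * x + Y x\<close>, and admissibility
    excludes a final short position.\<close>
  then have "p * x' + Y x' \<le> p * x + Y x" "0 \<le> p * h\<^sub>X"
    using x' assms by (auto simp: spot_prices_eq)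
  then show ?case by simp
next
  case (External q s)
  from External.IH[of x "h\<^sub>X - q" "h\<^sub>Y + p * q"] External.prems show ?case
    by (simp add: algebra_simps)
next
  case (Request r \<sigma>)
  define z where "z = x + amount r"
  define h where "h = h\<^sub>Y + (Y x - Y z) - noise_fee f k x (amount r) (N r)"
  define E where "E \<eta> = expected_Y f k N (noise_fee f k) p (\<sigma> (z + \<eta>)) (z + \<eta>) (h\<^sub>X - amount r) h" for \<eta>
  have acc: "accepted N x r"
    and adm: "\<And>\<eta>. \<eta> \<in> msupport (N r) \<Longrightarrow>
      admissible f k N (noise_fee f k) p (\<sigma> (z + \<eta>)) (z + \<eta>) (h\<^sub>X - amount r) h"
    and int: "integrable (N r) E"
    using Request.prems(2) by (simp_all add: z_def h_def E_def[abs_def] Let_def)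
  \<comment> \<open>By induction \<open>E \<eta>\<close> is at most the bound at state
    \<open>z + \<eta>\<close>; \<open>c\<close> collects the terms free of
    \<open>\<eta>\<close>.\<close>
  define c where "c = h + p * (h\<^sub>X - amount r) + p * z - (p * x' + Y x')"
  have "(LINT \<eta>|N r. E \<eta>) \<le> (LINT \<eta>|N r. c + p * \<eta> + (if 0 < z + \<eta> then Y (z + \<eta>) else 0))"
  proof (rule integral_mono_AE[OF int])
    show "integrable (N r) (\<lambda>\<eta>. c + p * \<eta> + (if 0 < z + \<eta> then Y (z + \<eta>) else 0))"
      unfolding z_def by (rule integral_affine_Y(1)[OF acc])
    show "AE \<eta> in N r. E \<eta> \<le> c + p * \<eta> + (if 0 < z + \<eta> then Y (z + \<eta>) else 0)"
      using AE_msupport[OF sets_N[OF acc]]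
    proof eventually_elim
      case (elim \<eta>)
      have "0 < z + \<eta>"
        using elim acc by (auto simp: z_def accepted_def)
      then show ?case
        using Request.IH[OF _ _ adm[OF elim]] by (simp add: E_def c_def algebra_simps)
    qed
  qed
  also have "\<dots> = c + expected_reserve x r"
    unfolding z_def by (rule integral_affine_Y(2)[OF acc])
  \<comment> \<open>The fee contained in \<open>h\<close> is
    \<open>expected_reserve x r - Y z\<close>, so the expected reserve cancels.\<close>
  also have "\<dots> = h\<^sub>Y + p * h\<^sub>X + (p * x + Y x) - (p * x' + Y x')"
    by (simp add: c_def h_def z_def noise_fee_eq[OF acc] algebra_simps)
  finally show ?case
    by (simp add: E_def z_def h_def)
qed

text \<open>The single trade attains the bound of \<open>expected_Y_le\<close>, and utilities
  preserve the order.\<close>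

lemma truthful_noise_fee: "truthful f k N (noise_fee f k)"
  unfolding truthful_def
proof (intro allI impI conjI)
  fix p :: real assume "0 < p"
  then show "\<exists>x'>0. p \<in> spot_prices f x' (Y x')"
    by (rule spot_price_attained)
next
  fix p :: real and U :: "real \<Rightarrow> real" and x h\<^sub>X h\<^sub>Y x' l u s
  assume *: "0 < p" "0 < x" "0 < x'" "x' - x \<in> {l..u}" and "strict_mono U"
    and "p \<in> spot_prices f x' (Y x')"
  note single_trade = single_trade_value[OF *(2-4) privacy_fee_noise_fee]
  show "admissible f k N (noise_fee f k) p (single_trade l u x h\<^sub>X x') x h\<^sub>X h\<^sub>Y"
    by (rule single_trade)
  assume "admissible f k N (noise_fee f k) p s x h\<^sub>X h\<^sub>Y"
  then have "expected_Y f k N (noise_fee f k) p s x h\<^sub>X h\<^sub>Y \<le>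
      h\<^sub>Y + p * h\<^sub>X + (p * x + Y x) - (p * x' + Y x')"
    using * \<open>p \<in> _\<close> by (intro expected_Y_le)
  also have "\<dots> = expected_Y f k N (noise_fee f k) p (single_trade l u x h\<^sub>X x') x h\<^sub>X h\<^sub>Y"
    unfolding single_trade by (simp add: algebra_simps)
  finally show "U (expected_Y f k N (noise_fee f k) p s x h\<^sub>X h\<^sub>Y) \<le>
      U (expected_Y f k N (noise_fee f k) p (single_trade l u x h\<^sub>X x') x h\<^sub>X h\<^sub>Y)"
    using \<open>strict_mono U\<close> by (simp add: strict_mono_less_eq)
qed

text \<open>Requesting \<open>r\<close> first and then arbitraging the market maker gains
  \<open>noise_fee f k x (amount r) (N r) - \<gamma> x (amount r) (N r)\<close> over the single trade.\<close>

lemma noise_fee_le: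
  assumes \<gamma>: "privacy_fee N \<gamma>" and truthful: "truthful f k N \<gamma>"
    and "0 < x" and acc: "accepted N x r"
  shows "noise_fee f k x (amount r) (N r) \<le> \<gamma> x (amount r) (N r)"
proof -
  \<comment> \<open>Truthfulness at a single true price already bounds the fee at every state and
    request.\<close>
  obtain x' where x': "0 < x'" "1 \<in> spot_prices f x' (Y x')"
    using spot_price_attained[of 1] by auto
  define z where "z = x + amount r"
  define h where "h = Y x - Y z - \<gamma> x (amount r) (N r)"
  define c where "c = h - Y x' - amount r + (z - x')"
  \<comment> \<open>The second branch is never reached; it makes the payoff a measurable function of the noise.\<close>
  define \<sigma> where "\<sigma> t = (if 0 < t then single_trade (x' - t) (x' - t) t (- amount r) x'
    else External (t - x' - Y x' - amount r) Stop)" for t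
  \<comment> \<open>The sale in the second branch of \<open>\<sigma>\<close> is tuned so that both
    branches fit the form of \<open>integral_affine_Y\<close>.\<close>
  have payoff: "expected_Y f k N \<gamma> 1 (\<sigma> (z + \<eta>)) (z + \<eta>) (- amount r) h =
      c + 1 * \<eta> + (if 0 < z + \<eta> then Y (z + \<eta>) else 0)" for \<eta>
    using x'(1) \<gamma> by (simp add: \<sigma>_def single_trade_value c_def)
  have deviation: "expected_Y f k N \<gamma> 1 (Request r \<sigma>) x 0 0 = c + expected_reserve x r"
    using integral_affine_Y(2)[OF acc, of c 1] payoff unfolding z_def h_def by simp
  have "admissible f k N \<gamma> 1 (Request r \<sigma>) x 0 0"
  proof -
    have "admissible f k N \<gamma> 1 (\<sigma> (z + \<eta>)) (z + \<eta>) (- amount r) h" if "\<eta> \<in> msupport (N r)" for \<eta>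
      using acc that x'(1) \<gamma> by (auto simp: \<sigma>_def accepted_def z_def intro!: single_trade_value(1))
    moreover have "integrable (N r) (\<lambda>\<eta>. expected_Y f k N \<gamma> 1 (\<sigma> (z + \<eta>)) (z + \<eta>) (- amount r) h)"
      unfolding payoff unfolding z_def by (rule integral_affine_Y(1)[OF acc])
    ultimately show ?thesis
      using acc by (simp add: Let_def z_def h_def)
  qed
  moreover have "strict_mono (\<lambda>y::real. y)"
    by (simp add: strict_mono_def)
  ultimately have "expected_Y f k N \<gamma> 1 (Request r \<sigma>) x 0 0
      \<le> expected_Y f k N \<gamma> 1 (single_trade (x' - x) (x' - x) x 0 x') x 0 0"
    using truthful[unfolded truthful_def, rule_format, THEN conjunct2, rule_format,
        of 1 x 0 0 x' "\<lambda>y. y" "x' - x" "x' - x", THEN conjunct2, rule_format] x' \<open>0 < x\<close>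
    by (simp del: expected_Y.simps admissible.simps)
  then show ?thesis
    unfolding deviation single_trade_value(2)[OF \<open>0 < x\<close> x'(1) _ \<gamma>, of "x' - x" "x' - x", simplified]
    by (simp add: noise_fee_eq[OF acc] c_def h_def z_def)
qed

end

theorem theorem4p6:
  fixes f :: "real \<times> real \<Rightarrow> real" and k :: real and N :: noise
  assumes "cfmm f k"
    and "noise_mechanism N"
    and "zero_mean N"
  shows "(\<exists>\<gamma>. privacy_fee N \<gamma> \<and> truthful f k N \<gamma>) \<and>
    (privacy_fee N (noise_fee f k) \<and> truthful f k N (noise_fee f k)) \<and>
    (\<forall>\<gamma>. privacy_fee N \<gamma> \<and> truthful f k N \<gamma> \<longrightarrow>
       (\<forall>x>0. \<forall>r. accepted N x r \<longrightarrow>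
          noise_fee f k x (amount r) (N r) \<le> \<gamma> x (amount r) (N r))) \<and>
    (\<forall>x>0. \<forall>r. accepted N x r \<longrightarrow>
       noise_fee f k x (amount r) (N r) =
         (LINT \<eta>|N r. LBINT a=ereal (x + amount r + \<eta>)..ereal (x + amount r). spot_price f k a)) \<and>
    (\<forall>x>0. \<forall>r. \<forall>d \<in> borel_measurable borel.
       accepted N x r \<longrightarrow> (\<forall>\<eta>. 0 \<le> d \<eta>) \<longrightarrow> N r = density lborel (\<lambda>\<eta>. ennreal (d \<eta>)) \<longrightarrow>
       noise_fee f k x (amount r) (N r) =
         (LBINT \<eta>. d \<eta> * (LBINT a=ereal (x + amount r + \<eta>)..ereal (x + amount r).
            (spot_price f k a - spot_price f k (x + amount r)))) \<and>
       noise_fee f k x (amount r) (N r) =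
         (LBINT \<eta>. d \<eta> * (LBINT a=ereal (x + amount r + \<eta>)..ereal (x + amount r).
            spot_price f k a)))"
proof -
  interpret noisy_market f k N
    using assms by unfold_locales
  \<comment> \<open>The integrand \<open>g\<close> is arbitrary so that both forms of the noise fee
    are instances.\<close>
  have density: "(LINT \<eta>|N r. LBINT a=ereal (x + amount r + \<eta>)..ereal (x + amount r). g a) =
      (LBINT \<eta>. d \<eta> * (LBINT a=ereal (x + amount r + \<eta>)..ereal (x + amount r). g a))"
    if "d \<in> borel_measurable borel" "\<forall>\<eta>. 0 \<le> d \<eta>" "N r = density lborel (\<lambda>\<eta>. ennreal (d \<eta>))"
    for x r and d g :: "real \<Rightarrow> real"
  proof -
    have "(\<lambda>\<eta>. LBINT a=ereal (x + amount r + \<eta>)..ereal (x + amount r). g a) \<in> borel_measurable lborel"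
      by (rule measurable_compose[OF _ borel_measurable_interval_integral]) simp
    from integral_density[OF this, of d] that show ?thesis
      by simp
  qed
  have fee_density:
    "noise_fee f k x (amount r) (N r) = (LBINT \<eta>. d \<eta> *
      (LBINT a=ereal (x + amount r + \<eta>)..ereal (x + amount r). (P a - P (x + amount r))))"
    "noise_fee f k x (amount r) (N r) = (LBINT \<eta>. d \<eta> *
      (LBINT a=ereal (x + amount r + \<eta>)..ereal (x + amount r). P a))"
    if "accepted N x r" "d \<in> borel_measurable borel" "\<forall>\<eta>. 0 \<le> d \<eta>"
      "N r = density lborel (\<lambda>\<eta>. ennreal (d \<eta>))" for x r d
    unfolding density[OF that(2-4), symmetric]
    by (simp_all only: noise_fee_def noise_fee_simplified[OF that(1), unfolded noise_fee_def])
  show ?thesis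
    by (intro conjI allI ballI impI exI[of _ "noise_fee f k"])
      (blast intro: privacy_fee_noise_fee truthful_noise_fee noise_fee_le noise_fee_simplified
        fee_density)+
qed

end
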